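(* Define integer sequences $\alpha(n)$ and $\beta(n)$ by the formal power series expansions $$\sum_{n\ge0}\alpha(n)q^n=\frac{(q,q^4;q^5)_\infty^2(-q^4,-q^6;q^{10})_\infty}{(q^2,q^3;q^5)_\infty^2(-q^2,-q^8;q^{10})_\infty},\qquad \sum_{n\ge0}\beta(n)q^n=\frac{(q^2,q^3;q^5)_\infty^2(-q^2,-q^8;q^{10})_\infty}{(q,q^4;q^5)_\infty^2(-q^4,-q^6;q^{10})_\infty}.$$ Then for every integer $n\ge 0$, $$\alpha(10n+3)=\alpha(10n+7)=0\quad\text{and}\quad \beta(10n+3)=\beta(10n+7)=0.$$
   Context: $(A;q)_\infty=\prod_{k\ge0}(1-Aq^k)$ and $(A_1,\dots,A_n;q)_\infty=(A_1;q)_\infty\cdots(A_n;q)_\infty$. The first product equals $\nu(q^2)=R(q)^2R(q^2)/R(q^4)$ and the second its reciprocal, where $R(q)=\frac{(q,q^4;q^5)_\infty}{(q^2,q^3;q^5)_\infty}$ is the Rogers–Ramanujan continued fraction (without the factor $q^{1/5}$). *)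

theory Defs
  imports "HOL-Analysis.Analysis"
begin

text \<open>
  For formal power series, the infinite product is taken in the library's \<open>X\<close>-adic topology
  on \<^typ>\<open>'a fps\<close>; it converges whenever both arguments have zero constant term
  (lemma \<open>convergent_prod_qpoch_fps\<close> below).
\<close>

definition qpoch_inf :: "'a \<Rightarrow> 'a \<Rightarrow> 'a :: {t2_space, comm_ring_1}" where
  "qpoch_inf A q = (\<Prod>k. 1 - A * q ^ k)"

definition qpochs_inf :: "'a list \<Rightarrow> 'a \<Rightarrow> 'a :: {t2_space, comm_ring_1}" where
  "qpochs_inf As q = (\<Prod>A\<leftarrow>As. qpoch_inf A q)"

lemma fps_mult_power_nth_eq_0:
  fixes A q :: "'a :: idom fps"
  assumes "fps_nth A 0 = 0" "fps_nth q 0 = 0" "n \<le> k"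
  shows   "fps_nth (A * q ^ k) n = 0"
proof -
  have "fps_X dvd f" if "fps_nth f 0 = 0" for f :: "'a fps"
  proof
    show "f = fps_X * fps_shift 1 f"
      by (rule fps_ext) (use that in auto)
  qed
  hence "fps_X dvd A" "fps_X dvd q"
    using assms by auto
  hence "fps_X * fps_X ^ k dvd A * q ^ k"
    by (intro mult_dvd_mono dvd_power_same)
  then obtain B where "A * q ^ k = fps_X ^ Suc k * B"
    by (auto elim!: dvdE)
  thus ?thesis using assms(3) by (simp only: fps_X_power_mult_nth) simp
qed

lemma qpoch_fps_partial_stable:
  fixes A q :: "'a :: idom fps"
  assumes "fps_nth A 0 = 0" "fps_nth q 0 = 0" "n \<le> N"
  shows   "fps_nth (\<Prod>k\<le>N. 1 - A * q ^ k) n = fps_nth (\<Prod>k\<le>n. 1 - A * q ^ k) n"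
  using assms(3)
proof (induction N rule: dec_induct)
  case (step N)
  have "fps_nth (\<Prod>k\<le>Suc N. 1 - A * q ^ k) n =
        fps_nth (\<Prod>k\<le>N. 1 - A * q ^ k) n - fps_nth ((\<Prod>k\<le>N. 1 - A * q ^ k) * (A * q ^ Suc N)) n"
    by (simp add: algebra_simps)
  also have "fps_nth ((\<Prod>k\<le>N. 1 - A * q ^ k) * (A * q ^ Suc N)) n = 0"
    unfolding fps_mult_nth[of "prod _ _"]
    using step assms by (intro sum.neutral ballI) (simp add: fps_mult_power_nth_eq_0 del: power_Suc)
  finally show ?case using step by simp
qed auto

lemma qpoch_fps_has_prod:
  fixes A q :: "'a :: idom fps"
  assumes "fps_nth A 0 = 0" "fps_nth q 0 = 0"
  shows   "(\<lambda>k. 1 - A * q ^ k) has_prod Abs_fps (\<lambda>n. fps_nth (\<Prod>k\<le>n. 1 - A * q ^ k) n)"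
    (is "_ has_prod ?P")
proof -
  have "(\<lambda>N. \<Prod>k\<le>N. 1 - A * q ^ k) \<longlonglongrightarrow> ?P"
  proof (rule tendsto_fpsI)
    fix n
    show "eventually (\<lambda>N. fps_nth (\<Prod>k\<le>N. 1 - A * q ^ k) n = fps_nth ?P n) sequentially"
      using eventually_ge_at_top[of n]
      by eventually_elim (simp only: fps_nth_Abs_fps, rule qpoch_fps_partial_stable[OF assms])
  qed
  moreover have "fps_nth ?P 0 = 1"
    using assms by simp
  hence "?P \<noteq> 0"
    by (metis fps_zero_nth zero_neq_one)
  ultimately show ?thesis
    by (simp add: has_prod_def raw_has_prod_def)
qed

lemma convergent_prod_qpoch_fps:
  fixes A q :: "'a :: idom fps"
  assumes "fps_nth A 0 = 0" "fps_nth q 0 = 0"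
  shows   "convergent_prod (\<lambda>k. 1 - A * q ^ k)"
  using qpoch_fps_has_prod[OF assms]
  unfolding has_prod_def convergent_prod_def by blast

lemma qpoch_inf_fps_nth:
  fixes A q :: "'a :: idom fps"
  assumes "fps_nth A 0 = 0" "fps_nth q 0 = 0"
  shows   "fps_nth (qpoch_inf A q) n = fps_nth (\<Prod>k\<le>n. 1 - A * q ^ k) n"
  unfolding qpoch_inf_def has_prod_unique[OF qpoch_fps_has_prod[OF assms], symmetric]
  by (rule fps_nth_Abs_fps)

text \<open>
  The library's division of power series needs division of coefficients, so the quotients of
  infinite products are formed over \<^typ>\<open>rat\<close>. Their coefficients are nevertheless
  integers (lemma \<open>alpha_beta_exist\<close>).
\<close>

definition unit_int_fps :: "rat fps \<Rightarrow> bool" where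
  "unit_int_fps f \<longleftrightarrow> fps_nth f 0 = 1 \<and> (\<forall>n. fps_nth f n \<in> \<int>)"

lemma unit_int_fps_mult: "unit_int_fps f \<Longrightarrow> unit_int_fps g \<Longrightarrow> unit_int_fps (f * g)"
  unfolding unit_int_fps_def by (auto simp: fps_mult_nth intro!: Ints_sum Ints_mult)

lemma unit_int_fps_divide:
  assumes "unit_int_fps f" "unit_int_fps g"
  shows   "unit_int_fps (f / g)"
proof -
  have g: "fps_nth g 0 = 1" "fps_nth g n \<in> \<int>" for n
    using assms by (auto simp: unit_int_fps_def)
  have "fps_nth (inverse g) n \<in> \<int>" for n
  proof (induction n rule: less_induct)
    case (less n)
    show ?case
    proof (cases n)
      case (Suc m)
      have "fps_nth (inverse g) n = - (\<Sum>i=1..n. fps_nth g i * fps_nth (inverse g) (n - i))"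
        using Suc g by (simp add: fps_inverse_def)
      also have "\<dots> \<in> \<int>"
        using less g by (intro Ints_minus Ints_sum Ints_mult) auto
      finally show ?thesis .
    qed (use g in auto)
  qed
  hence "unit_int_fps (inverse g)" using g by (simp add: unit_int_fps_def)
  with assms(1) g show ?thesis by (simp add: fps_divide_unit unit_int_fps_mult)
qed

lemma unit_int_fps_qpoch_inf:
  assumes "fps_nth A 0 = 0" "fps_nth q 0 = 0" "\<And>n. fps_nth A n \<in> \<int>" "\<And>n. fps_nth q n \<in> \<int>"
  shows   "unit_int_fps (qpoch_inf A q)"
proof -
  have Q: "fps_nth (q ^ k) n \<in> \<int>" for k n
    using assms(4) by (induction k arbitrary: n) (auto simp: fps_mult_nth intro!: Ints_sum Ints_mult)
  have "unit_int_fps (1 - A * q ^ k)" for k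
    using assms Q by (auto simp: unit_int_fps_def fps_mult_nth intro!: Ints_sum Ints_mult Ints_diff)
  note factor = this
  have "unit_int_fps (\<Prod>k\<le>n. 1 - A * q ^ k)" for n :: nat
  proof (induction n)
    case 0
    show ?case using factor[of 0] by simp
  next
    case (Suc n)
    thus ?case using factor[of "Suc n"] by (simp add: unit_int_fps_mult)
  qed
  thus ?thesis
    using qpoch_inf_fps_nth[OF assms(1,2)] assms(1) by (simp add: unit_int_fps_def)
qed

lemma unit_int_fps_power: "unit_int_fps f \<Longrightarrow> unit_int_fps (f ^ k)"
  by (induction k) (simp_all add: unit_int_fps_mult, simp add: unit_int_fps_def)

lemma unit_int_fps_qpochs_inf:
  assumes "\<And>A. A \<in> set As \<Longrightarrow> fps_nth A 0 = 0 \<and> (\<forall>n. fps_nth A n \<in> \<int>)"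
    and "fps_nth q 0 = 0" "\<And>n. fps_nth q n \<in> \<int>"
  shows   "unit_int_fps (qpochs_inf As q)"
  using assms(1)
proof (induction As)
  case Nil
  show ?case by (simp add: qpochs_inf_def unit_int_fps_def)
next
  case (Cons A As)
  have "unit_int_fps (qpoch_inf A q)"
    using Cons.prems[of A] assms(2,3) by (intro unit_int_fps_qpoch_inf) auto
  moreover have "unit_int_fps (qpochs_inf As q)"
    using Cons.prems by (intro Cons.IH) auto
  ultimately show ?case
    by (simp add: qpochs_inf_def unit_int_fps_mult)
qed

lemma unit_int_fps_imp_ex:
  assumes "unit_int_fps f"
  shows   "\<exists>a :: nat \<Rightarrow> int. Abs_fps (\<lambda>n. of_int (a n)) = f"
proof -
  have "\<exists>a. \<forall>n. fps_nth f n = of_int (a n)"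
    using assms by (intro choice) (auto simp: unit_int_fps_def elim: Ints_cases)
  thus ?thesis by (auto simp: fps_eq_iff)
qed

lemma alpha_beta_exist:
  "\<exists>\<alpha> :: nat \<Rightarrow> int. Abs_fps (\<lambda>n. of_int (\<alpha> n) :: rat) =
     (qpochs_inf [fps_X, fps_X ^ 4] (fps_X ^ 5) ^ 2 *
      qpochs_inf [- (fps_X ^ 4), - (fps_X ^ 6)] (fps_X ^ 10)) /
     (qpochs_inf [fps_X ^ 2, fps_X ^ 3] (fps_X ^ 5) ^ 2 *
      qpochs_inf [- (fps_X ^ 2), - (fps_X ^ 8)] (fps_X ^ 10))"
  "\<exists>\<beta> :: nat \<Rightarrow> int. Abs_fps (\<lambda>n. of_int (\<beta> n) :: rat) =
     (qpochs_inf [fps_X ^ 2, fps_X ^ 3] (fps_X ^ 5) ^ 2 *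
      qpochs_inf [- (fps_X ^ 2), - (fps_X ^ 8)] (fps_X ^ 10)) /
     (qpochs_inf [fps_X, fps_X ^ 4] (fps_X ^ 5) ^ 2 *
      qpochs_inf [- (fps_X ^ 4), - (fps_X ^ 6)] (fps_X ^ 10))"
  by (intro unit_int_fps_imp_ex unit_int_fps_divide unit_int_fps_mult unit_int_fps_power
        unit_int_fps_qpochs_inf; auto)+

end

theory Submission
  imports Defs
begin

text \<open>
  Let \<open>F\<close> be the first quotient and write \<open>T\<^sub>a = (q\<^sup>a, q\<^bsup>10-a\<^esup>; q\<^bsup>10\<^esup>)\<^sub>\<infinity>\<close>, and \<open>S\<^sub>a\<close> for the same
  product with both parameters negated. Up to factors in \<open>q\<^sup>2\<close>, \<open>F\<close> is \<open>(T\<^sub>1 / T\<^sub>3)\<^sup>2\<close>, and so also the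
  square of \<open>W = T\<^sub>1 S\<^sub>3 (q\<^bsup>10\<^esup>; q\<^bsup>10\<^esup>)\<^sup>2\<close>, because \<open>T\<^sub>3 S\<^sub>3\<close> is a series in \<open>q\<^sup>2\<close>. As a product of two theta
  functions, \<open>W = f(-q, -q\<^sup>9) f(q\<^sup>3, q\<^sup>7)\<close> is a sum over pairs of integers \<open>(i, j)\<close>; the parity of \<open>i + j\<close>
  splits it as \<open>A - q B\<close> with \<open>A\<close> and \<open>B\<close> products of theta functions in \<open>q\<^sup>2\<close>. Hence the odd part of \<open>F\<close>
  is a product, and it collapses to \<open>-2q (q\<^sup>4; q\<^sup>4) (q\<^bsup>20\<^esup>; q\<^bsup>20\<^esup>)\<^sup>3 / (q\<^bsup>10\<^esup>; q\<^bsup>10\<^esup>)\<^sup>4\<close>. By the pentagonal number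
  theorem \<open>q (q\<^sup>4; q\<^sup>4)\<close> only has exponents \<open>6j\<^sup>2 - 2j + 1 \<equiv> (j - 1)\<^sup>2\<close> modulo 5, which avoid the
  residues 2 and 3. For the reciprocal of \<open>F\<close> the same argument applies with \<open>W = S\<^sub>1 T\<^sub>3 (q\<^bsup>10\<^esup>; q\<^bsup>10\<^esup>)\<^sup>2 = A + q B\<close>.
\<close>

subsection \<open>Formal power series topology and infinite products\<close>

lemma fps_X_power_dvd_iff: "fps_X ^ m dvd (f :: 'a :: comm_ring_1 fps) \<longleftrightarrow> (\<forall>i<m. fps_nth f i = 0)"
proof
  assume "\<forall>i<m. fps_nth f i = 0"
  hence "f = fps_X ^ m * fps_shift m f"
    by (auto simp: fps_eq_iff fps_X_power_mult_nth)
  thus "fps_X ^ m dvd f" ..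
qed (auto simp: dvd_def fps_X_power_mult_nth)

instance fps :: (group_add) topological_monoid_add
proof
  fix f g :: "'a fps"
  have lim: "(fst \<longlongrightarrow> f) (nhds f \<times>\<^sub>F nhds g)" "(snd \<longlongrightarrow> g) (nhds f \<times>\<^sub>F nhds g)"
    by (rule filterlim_fst filterlim_snd)+
  show "LIM x nhds f \<times>\<^sub>F nhds g. fst x + snd x :> nhds (f + g)"
  proof (rule tendsto_fpsI)
    fix n
    have "eventually (\<lambda>x. fps_nth (fst x) n = fps_nth f n) (nhds f \<times>\<^sub>F nhds g)"
         "eventually (\<lambda>x. fps_nth (snd x) n = fps_nth g n) (nhds f \<times>\<^sub>F nhds g)"
      using lim unfolding tendsto_fps_iff by simp_all
    thus "eventually (\<lambda>x. fps_nth (fst x + snd x) n = fps_nth (f + g) n) (nhds f \<times>\<^sub>F nhds g)"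
      by eventually_elim simp
  qed
qed

instance fps :: (ab_group_add) topological_comm_monoid_add ..

instance fps :: (ring) topological_semigroup_mult
proof
  fix f g :: "'a fps"
  have lim: "(fst \<longlongrightarrow> f) (nhds f \<times>\<^sub>F nhds g)" "(snd \<longlongrightarrow> g) (nhds f \<times>\<^sub>F nhds g)"
    by (rule filterlim_fst filterlim_snd)+
  show "LIM x nhds f \<times>\<^sub>F nhds g. fst x * snd x :> nhds (f * g)"
  proof (rule tendsto_fpsI)
    fix n
    have "eventually (\<lambda>x. \<forall>i\<in>{..n}. fps_nth (fst x) i = fps_nth f i) (nhds f \<times>\<^sub>F nhds g)"
         "eventually (\<lambda>x. \<forall>i\<in>{..n}. fps_nth (snd x) i = fps_nth g i) (nhds f \<times>\<^sub>F nhds g)"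
      using lim unfolding tendsto_fps_iff by (subst eventually_ball_finite_distrib; simp)+
    thus "eventually (\<lambda>x. fps_nth (fst x * snd x) n = fps_nth (f * g) n) (nhds f \<times>\<^sub>F nhds g)"
      by eventually_elim (auto simp: fps_mult_nth intro!: sum.cong)
  qed
qed

instance fps :: (ring_1) topological_monoid_mult ..
instance fps :: (comm_ring_1) topological_comm_monoid_mult ..

section \<open>Infinite q-products: limits, congruences and factorisations\<close>

lemma qpoch_inf_tendsto:
  fixes A q :: "'a :: idom fps"
  assumes "fps_nth A 0 = 0" "fps_nth q 0 = 0"
  shows "(\<lambda>N. \<Prod>k<N. 1 - A * q ^ k) \<longlonglongrightarrow> qpoch_inf A q"
proof -
  have "(\<lambda>N. \<Prod>k\<le>N. 1 - A * q ^ k) \<longlonglongrightarrow> qpoch_inf A q"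
  proof (rule tendsto_fpsI)
    fix n
    show "eventually (\<lambda>N. fps_nth (\<Prod>k\<le>N. 1 - A * q ^ k) n = fps_nth (qpoch_inf A q) n) sequentially"
      using eventually_ge_at_top[of n]
      by eventually_elim (metis qpoch_inf_fps_nth[OF assms] qpoch_fps_partial_stable[OF assms])
  qed
  thus ?thesis
    by (subst filterlim_sequentially_Suc[symmetric]) (simp add: lessThan_Suc_atMost)
qed

text \<open>Turns convergence into divisibility by a power of \<open>fps_X\<close>, so that
  \<open>qbinomial_cong\<close> can be proved by ring algebra.\<close>

lemma qpoch_inf_cong:
  fixes A q :: "'a :: idom fps"
  assumes "fps_nth A 0 = 0" "fps_nth q 0 = 0" "n \<le> N"
  shows "fps_X ^ n dvd qpoch_inf A q - (\<Prod>k<N. 1 - A * q ^ k)"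
  unfolding fps_X_power_dvd_iff
proof safe
  fix i assume "i < n"
  then obtain M where "N = Suc M" "i \<le> M"
    using assms(3) by (cases N) auto
  thus "fps_nth (qpoch_inf A q - (\<Prod>k<N. 1 - A * q ^ k)) i = 0"
    using qpoch_fps_partial_stable[OF assms(1,2), of i M]
    by (simp add: lessThan_Suc_atMost qpoch_inf_fps_nth[OF assms(1,2)])
qed

lemma qpoch_inf_nth_0:
  fixes A q :: "'a :: idom fps"
  assumes "fps_nth A 0 = 0" "fps_nth q 0 = 0"
  shows "fps_nth (qpoch_inf A q) 0 = 1"
  using assms by (simp add: qpoch_inf_fps_nth)

text \<open>Sorts the factors by the residue of \<open>k\<close> modulo \<open>m\<close>; a partial
  product with \<open>N * m\<close> factors splits exactly.\<close>

lemma qpoch_inf_split: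
  fixes A q :: "'a :: idom fps"
  assumes "fps_nth A 0 = 0" "fps_nth q 0 = 0" "m > 0"
  shows "qpoch_inf A q = (\<Prod>i<m. qpoch_inf (A * q ^ i) (q ^ m))"
proof -
  have "(\<lambda>N. \<Prod>k<N * m. 1 - A * q ^ k) \<longlonglongrightarrow> qpoch_inf A q"
    using assms(3)
    by (intro filterlim_compose[OF qpoch_inf_tendsto[OF assms(1,2)]] mult_nat_right_at_top)
  also have "(\<lambda>N. \<Prod>k<N * m. 1 - A * q ^ k) = (\<lambda>N. \<Prod>i<m. \<Prod>k<N. 1 - (A * q ^ i) * (q ^ m) ^ k)"
  proof
    fix N
    have "(\<Prod>k<N * m. 1 - A * q ^ k) = (\<Prod>k<N. \<Prod>i=k*m..<k*m+m. 1 - A * q ^ i)"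
      by (rule prod.nat_group[symmetric])
    also have "\<dots> = (\<Prod>k<N. \<Prod>i<m. 1 - (A * q ^ i) * (q ^ m) ^ k)"
      by (simp add: prod.atLeastLessThan_shift_0[of _ "_ * m"] lessThan_atLeast0 power_add
            power_mult[symmetric] mult_ac)
    also have "\<dots> = (\<Prod>i<m. \<Prod>k<N. 1 - (A * q ^ i) * (q ^ m) ^ k)"
      by (rule prod.swap)
    finally show "(\<Prod>k<N * m. 1 - A * q ^ k) = (\<Prod>i<m. \<Prod>k<N. 1 - (A * q ^ i) * (q ^ m) ^ k)" .
  qed
  finally have "(\<lambda>N. \<Prod>i<m. \<Prod>k<N. 1 - (A * q ^ i) * (q ^ m) ^ k) \<longlonglongrightarrow> qpoch_inf A q" .
  moreover have "(\<lambda>N. \<Prod>i<m. \<Prod>k<N. 1 - (A * q ^ i) * (q ^ m) ^ k) \<longlonglongrightarrow>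
                 (\<Prod>i<m. qpoch_inf (A * q ^ i) (q ^ m))"
    using assms by (intro tendsto_prod' qpoch_inf_tendsto) (auto simp: fps_nth_power_0)
  ultimately show ?thesis
    by (rule LIMSEQ_unique)
qed

lemma qpoch_inf_mult_minus:
  fixes A q :: "'a :: idom fps"
  assumes "fps_nth A 0 = 0" "fps_nth q 0 = 0"
  shows "qpoch_inf A q * qpoch_inf (- A) q = qpoch_inf (A ^ 2) (q ^ 2)"
proof -
  have "(\<lambda>N. (\<Prod>k<N. 1 - A * q ^ k) * (\<Prod>k<N. 1 - (- A) * q ^ k)) \<longlonglongrightarrow> qpoch_inf A q * qpoch_inf (- A) q"
    using assms by (intro tendsto_mult qpoch_inf_tendsto) auto
  also have "(\<lambda>N. (\<Prod>k<N. 1 - A * q ^ k) * (\<Prod>k<N. 1 - (- A) * q ^ k)) = (\<lambda>N. \<Prod>k<N. 1 - A ^ 2 * (q ^ 2) ^ k)"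
    by (simp add: prod.distrib[symmetric] algebra_simps power2_eq_square power_mult_distrib)
  finally show ?thesis
    using assms by (intro LIMSEQ_unique[OF _ qpoch_inf_tendsto]) (auto simp: fps_nth_power_0)
qed

subsection \<open>The Jacobi triple product\<close>

text \<open>Gaussian binomial coefficients, given by a q-Pascal rule instead of a quotient so that
  they make sense over any commutative ring.\<close>

fun qbinomial :: "'a :: comm_ring_1 \<Rightarrow> nat \<Rightarrow> nat \<Rightarrow> 'a" where
  "qbinomial q n 0 = 1"
| "qbinomial q 0 (Suc k) = 0"
| "qbinomial q (Suc n) (Suc k) = qbinomial q n k + q ^ Suc k * qbinomial q n (Suc k)"

lemma qbinomial_eq_0: "n < k \<Longrightarrow> qbinomial q n k = 0"
  by (induction q n k rule: qbinomial.induct) auto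

lemma qbinomial_fact:
  "k \<le> n \<Longrightarrow> qbinomial q n k * (\<Prod>i<k. 1 - q * q ^ i) * (\<Prod>i<n-k. 1 - q * q ^ i) = (\<Prod>i<n. 1 - q * q ^ i)"
proof (induction q n k rule: qbinomial.induct)
  case (3 q n k)
  let ?P = "\<lambda>n. \<Prod>i<n. 1 - q * q ^ i"
  show ?case
  proof (cases "k = n")
    case True
    thus ?thesis using 3 by (simp add: qbinomial_eq_0 mult.assoc[symmetric])
  next
    case False
    then obtain d where d: "n = Suc k + d"
      using 3 by (metis Suc_leI Suc_le_mono le_add_diff_inverse le_neq_implies_less)
    have IH: "qbinomial q n k * ?P k * ?P (Suc d) = ?P n"
             "qbinomial q n (Suc k) * ?P (Suc k) * ?P d = ?P n"
      using 3 d by (simp_all del: prod.lessThan_Suc)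
    \<comment> \<open>The q-Pascal rule matches
      \<open>1 - q^(n+1) = (1 - q^(k+1)) + q^(k+1) * (1 - q^(d+1))\<close>.\<close>
    have "qbinomial q (Suc n) (Suc k) * ?P (Suc k) * ?P (Suc n - Suc k) =
          (1 - q * q ^ k) * (qbinomial q n k * ?P k * ?P (Suc d)) +
          q ^ Suc k * (1 - q * q ^ d) * (qbinomial q n (Suc k) * ?P (Suc k) * ?P d)"
      by (simp add: d algebra_simps)
    also have "\<dots> = ?P (Suc n)"
      unfolding IH by (simp add: d algebra_simps power_add)
    finally show ?thesis .
  qed
qed auto

text \<open>
  The general term of Ramanujan's theta function \<open>f(x, y)\<close>. Its exponents are never negative, so
  no inverses of \<open>x\<close> and \<open>y\<close> are needed.
\<close>

definition ramanujan_term :: "'a \<Rightarrow> 'a \<Rightarrow> int \<Rightarrow> 'a :: comm_ring_1" where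
  "ramanujan_term x y j = x ^ nat (j * (j + 1) div 2) * y ^ nat (j * (j - 1) div 2)"

lemma triangular_step: "(j + 1) * (j + 2) div 2 = j * (j + 1) div 2 + (j + 1 :: int)"
proof -
  have "(j + 1) * (j + 2) = j * (j + 1) + (j + 1) * 2"
    by (simp add: algebra_simps)
  thus ?thesis by simp
qed

lemma ramanujan_term_Suc:
  assumes "0 \<le> j"
  shows "ramanujan_term x y (j + 1) = ramanujan_term x y j * x * (x * y) ^ nat j"
proof -
  define a b where "a = j * (j + 1) div 2" and "b = j * (j - 1) div 2"
  have "j * (j - 1) \<ge> 0"
    using assms by (cases "j = 0") auto
  hence "0 \<le> a" "0 \<le> b"
    using assms by (auto simp: a_def b_def)
  moreover have "(j + 1) * (j + 1 + 1) div 2 = a + (j + 1)"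
    using triangular_step[of j] by (simp add: a_def add.assoc)
  moreover have "(j + 1) * (j + 1 - 1) div 2 = b + j"
    using triangular_step[of "j - 1"] by (simp add: b_def mult.commute add.commute)
  ultimately have "nat ((j + 1) * (j + 1 + 1) div 2) = nat a + Suc (nat j)"
                  "nat ((j + 1) * (j + 1 - 1) div 2) = nat b + nat j"
    using assms by linarith+
  thus ?thesis
    by (simp only: ramanujan_term_def a_def[symmetric] b_def[symmetric])
       (simp add: power_add power_mult_distrib mult_ac)
qed

lemma ramanujan_term_commute: "ramanujan_term x y (- j) = ramanujan_term y x j"
  by (simp add: ramanujan_term_def algebra_simps)

lemma ramanujan_term_pred:
  assumes "j \<le> 0"
  shows "ramanujan_term x y (j - 1) = ramanujan_term x y j * y * (x * y) ^ nat (- j)"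
proof -
  have "ramanujan_term x y (j - 1) = ramanujan_term y x (- j + 1)"
    using ramanujan_term_commute[of x y "- j + 1"] by simp
  also have "\<dots> = ramanujan_term y x (- j) * y * (y * x) ^ nat (- j)"
    using assms by (intro ramanujan_term_Suc) auto
  also have "ramanujan_term y x (- j) = ramanujan_term x y j"
    using ramanujan_term_commute[of x y "- j"] by simp
  finally show ?thesis
    by (simp only: mult.commute[of y x])
qed

text \<open>Formally, term \<open>j - 1\<close> is term \<open>j\<close> times
  \<open>y * (x * y)^(-j)\<close>. The factor \<open>(x * y) ^ N\<close> keeps all exponents
  non-negative.\<close>

lemma ramanujan_term_shift:
  assumes "0 \<le> j + int N"
  shows "ramanujan_term x y j * (y * (x * y) ^ N) = (x * y) ^ nat (j + int N) * ramanujan_term x y (j - 1)"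
proof -
  define K where "K = nat (j + int N)"
  have K: "int K = j + int N"
    using assms by (simp add: K_def)
  have "ramanujan_term x y j * (y * (x * y) ^ N) = (x * y) ^ K * ramanujan_term x y (j - 1)"
  proof (cases "j \<le> 0")
    case True
    then obtain L where L: "j = - int L"
      by (metis minus_equation_iff neg_0_le_iff_le nonneg_int_cases)
    hence "N = K + L"
      using K by linarith
    thus ?thesis
      using ramanujan_term_pred[OF True, of x y] L by (simp add: power_add mult_ac)
  next
    case False
    then obtain L where L: "j = int (Suc L)"
      by (metis not_le zero_less_imp_eq_int gr0_implies_Suc)
    hence "K = L + Suc N"
      using K by linarith
    thus ?thesis
      using ramanujan_term_Suc[of "int L" x y] L by (simp add: power_add mult_ac add.commute)
  qed
  thus ?thesis by (simp only: K_def)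
qed

text \<open>The q-binomial theorem with base \<open>x * y\<close>. Peeling off the factor at
  \<open>k = 0\<close> replaces \<open>z\<close> by \<open>z * (x * y)\<close> in the rest, hence
  the induction over arbitrary \<open>z\<close>.\<close>

lemma triple_product_one_sided:
  fixes x y :: "'a :: comm_ring_1"
  shows "(\<Prod>k<M. 1 + z * (x * y) ^ k) =
         (\<Sum>k\<le>M. qbinomial (x * y) M k * (z ^ k * (x * y) ^ (k * (k - 1) div 2)))"
proof (induction M arbitrary: z)
  case (Suc M)
  let ?q = "x * y"
  let ?t = "\<lambda>k. z ^ k * ?q ^ (k * (k - 1) div 2)"
  have tri: "Suc k * k div 2 = k * (k - 1) div 2 + k" for k :: nat
  proof -
    have "Suc k * k = k * (k - 1) + k * 2"
      by (cases k) auto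
    thus ?thesis by simp
  qed
  have t: "?t (Suc k) = ?t k * ?q ^ k * z" for k
    using tri[of k] by (simp add: power_add mult_ac)
  have "(\<Prod>k<Suc M. 1 + z * ?q ^ k) = (1 + z) * (\<Prod>k<M. 1 + (z * ?q) * ?q ^ k)"
    by (subst prod.lessThan_Suc_shift) (simp add: mult_ac)
  also have "(\<Prod>k<M. 1 + (z * ?q) * ?q ^ k) = (\<Sum>k\<le>M. qbinomial ?q M k * (?q ^ k * ?t k))" (is "_ = ?S")
    by (subst Suc.IH) (simp add: power_mult_distrib mult_ac)
  also have "(1 + z) * ?S = ?S + (\<Sum>k\<le>M. qbinomial ?q M k * ?t (Suc k))"
    unfolding t by (simp add: distrib_right sum.distrib sum_distrib_left mult_ac)
  \<comment> \<open>The added summand \<open>k = Suc M\<close> vanishes; with it both sums can be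
    indexed by \<open>Suc k\<close> and merged by the q-Pascal rule.\<close>
  also have "?S = (\<Sum>k\<le>Suc M. qbinomial ?q M k * (?q ^ k * ?t k))"
    by (simp add: qbinomial_eq_0)
  also have "\<dots> = 1 + (\<Sum>k\<le>M. qbinomial ?q M (Suc k) * (?q ^ Suc k * ?t (Suc k)))"
    by (subst sum.atMost_Suc_shift) simp
  also have "\<dots> + (\<Sum>k\<le>M. qbinomial ?q M k * ?t (Suc k)) =
      1 + (\<Sum>k\<le>M. qbinomial ?q (Suc M) (Suc k) * ?t (Suc k))"
    by (simp add: sum.distrib[symmetric] algebra_simps)
  also have "\<dots> = (\<Sum>k\<le>Suc M. qbinomial ?q (Suc M) k * ?t k)"
    by (subst sum.atMost_Suc_shift) simp
  finally show ?case .
qed auto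

text \<open>Induction on \<open>N\<close>, starting from the q-binomial theorem, avoids the usual
  substitution with negative powers of the base. Multiplying by \<open>1 + y * (x * y) ^ N\<close>
  gives two sums that merge by the q-Pascal rule.\<close>

lemma finite_triple_product:
  fixes x y :: "'a :: comm_ring_1"
  shows "(\<Prod>k<M. 1 + x * (x * y) ^ k) * (\<Prod>k<N. 1 + y * (x * y) ^ k) =
         (\<Sum>k\<le>M + N. qbinomial (x * y) (M + N) k * ramanujan_term x y (int k - int N))"
proof (induction N)
  case 0
  have "ramanujan_term x y (int k) = x ^ k * (x * y) ^ (k * (k - 1) div 2)" for k
  proof (induction k)
    case (Suc k)
    have "Suc k * k = k * (k - 1) + k * 2"
      by (cases k) auto
    hence "Suc k * (Suc k - 1) div 2 = k * (k - 1) div 2 + k" by simp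
    thus ?case
      using Suc ramanujan_term_Suc[of "int k" x y] by (simp add: power_add mult_ac add.commute)
  qed (simp add: ramanujan_term_def)
  thus ?case using triple_product_one_sided[of x x y M] by simp
next
  case (Suc N)
  let ?q = "x * y"
  let ?n = "M + N"
  let ?t = "\<lambda>k. ramanujan_term x y (int k - int (Suc N))"
  have t: "ramanujan_term x y (int k - int N) = ?t (Suc k)" for k
    by simp
  have s: "ramanujan_term x y (int k - int N) * (y * ?q ^ N) = ?q ^ k * ?t k" for k
    using ramanujan_term_shift[of "int k - int N" N x y] by (simp add: algebra_simps)
  have "(\<Prod>k<M. 1 + x * ?q ^ k) * (\<Prod>k<Suc N. 1 + y * ?q ^ k) =
     (\<Sum>k\<le>?n. qbinomial ?q ?n k * ramanujan_term x y (int k - int N)) * (1 + y * ?q ^ N)"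
    unfolding Suc.IH[symmetric] by (simp add: mult_ac)
  also have "\<dots> = (\<Sum>k\<le>?n. qbinomial ?q ?n k * ramanujan_term x y (int k - int N)) +
     (\<Sum>k\<le>?n. qbinomial ?q ?n k * (ramanujan_term x y (int k - int N) * (y * ?q ^ N)))"
    by (simp add: ring_distribs sum_distrib_right mult.assoc)
  also have "\<dots> = (\<Sum>k\<le>?n. qbinomial ?q ?n k * ?t (Suc k)) + (\<Sum>k\<le>?n. qbinomial ?q ?n k * (?q ^ k * ?t k))"
    unfolding s unfolding t ..
  also have "(\<Sum>k\<le>?n. qbinomial ?q ?n k * (?q ^ k * ?t k)) = (\<Sum>k\<le>Suc ?n. qbinomial ?q ?n k * (?q ^ k * ?t k))"
    by (simp add: qbinomial_eq_0)
  also have "\<dots> = ?t 0 + (\<Sum>k\<le>?n. qbinomial ?q ?n (Suc k) * (?q ^ Suc k * ?t (Suc k)))"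
    by (subst sum.atMost_Suc_shift) simp
  also have "(\<Sum>k\<le>?n. qbinomial ?q ?n k * ?t (Suc k)) + \<dots> =
      ?t 0 + (\<Sum>k\<le>?n. qbinomial ?q (Suc ?n) (Suc k) * ?t (Suc k))"
    by (simp add: sum.distrib[symmetric] algebra_simps)
  also have "\<dots> = (\<Sum>k\<le>M + Suc N. qbinomial ?q (M + Suc N) k * ?t k)"
    by (simp only: add_Suc_right sum.atMost_Suc_shift qbinomial.simps(1) mult_1_left)
  finally show ?case .
qed

text \<open>Only finitely many indices of each family affect coefficients up to \<open>n\<close>, so
  coefficient \<open>n\<close> of the product is a rearrangement of finite sums.\<close>

lemma has_sum_fps_mult:
  fixes f g :: "'a :: comm_ring_1 fps"
  assumes "(F has_sum f) A" "(G has_sum g) B"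
  shows "((\<lambda>(i, j). F i * G j) has_sum f * g) (A \<times> B)"
proof (rule has_sum_fpsI)
  fix n
  define I where "I = (\<Union>k\<le>n. {i \<in> A. fps_nth (F i) k \<noteq> 0})"
  define J where "J = (\<Union>k\<le>n. {j \<in> B. fps_nth (G j) k \<noteq> 0})"
  have IJ: "finite I" "finite J" "I \<subseteq> A" "J \<subseteq> B"
    using has_sum_fpsD(1)[OF assms(1)] has_sum_fpsD(1)[OF assms(2)] by (auto simp: I_def J_def)
  have f: "fps_nth f k = (\<Sum>i\<in>I. fps_nth (F i) k)" if "k \<le> n" for k
    unfolding has_sum_fpsD(2)[OF assms(1)]
    using that IJ by (intro sum.mono_neutral_left) (auto simp: I_def)
  have g: "fps_nth g k = (\<Sum>j\<in>J. fps_nth (G j) k)" if "k \<le> n" for k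
    unfolding has_sum_fpsD(2)[OF assms(2)]
    using that IJ by (intro sum.mono_neutral_left) (auto simp: J_def)
  let ?S = "{x \<in> A \<times> B. fps_nth (case x of (i, j) \<Rightarrow> F i * G j) n \<noteq> 0}"
  have sub: "?S \<subseteq> I \<times> J"
  proof safe
    fix i j assume ij: "i \<in> A" "j \<in> B" "fps_nth (F i * G j) n \<noteq> 0"
    then obtain k where "k \<le> n" "fps_nth (F i) k * fps_nth (G j) (n - k) \<noteq> 0"
      unfolding fps_mult_nth by (metis (mono_tags, lifting) atLeastAtMost_iff sum.neutral)
    hence "fps_nth (F i) k \<noteq> 0" "k \<le> n" "fps_nth (G j) (n - k) \<noteq> 0" "n - k \<le> n"
      by auto
    thus "i \<in> I" "j \<in> J"
      using ij unfolding I_def J_def by blast+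
  qed
  thus "finite ?S"
    using IJ by (auto intro: finite_subset)
  have "fps_nth (f * g) n = (\<Sum>k=0..n. (\<Sum>i\<in>I. fps_nth (F i) k) * (\<Sum>j\<in>J. fps_nth (G j) (n - k)))"
    by (simp add: fps_mult_nth f g)
  also have "\<dots> = (\<Sum>k=0..n. \<Sum>(i, j)\<in>I \<times> J. fps_nth (F i) k * fps_nth (G j) (n - k))"
    by (simp add: sum_product sum.cartesian_product)
  also have "\<dots> = (\<Sum>(i, j)\<in>I \<times> J. fps_nth (F i * G j) n)"
    by (subst sum.swap) (simp add: fps_mult_nth case_prod_unfold)
  also have "\<dots> = (\<Sum>x\<in>?S. fps_nth (case x of (i, j) \<Rightarrow> F i * G j) n)"
    using sub IJ by (intro sum.mono_neutral_cong_right) auto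
  finally show "fps_nth (f * g) n = \<dots>" .
qed

text \<open>The exponents of \<open>x\<close> and \<open>y\<close> add up to \<open>j * j\<close>,
  and both series are divisible by \<open>fps_X\<close>.\<close>

lemma fps_X_power_dvd_ramanujan_term:
  fixes x y :: "'a :: comm_ring_1 fps"
  assumes "fps_nth x 0 = 0" "fps_nth y 0 = 0"
  shows "fps_X ^ nat \<bar>j\<bar> dvd ramanujan_term x y j"
proof -
  have X: "fps_X dvd x" "fps_X dvd y"
    using assms fps_X_power_dvd_iff[of 1 x] fps_X_power_dvd_iff[of 1 y] by auto
  define a b where "a = j * (j + 1) div 2" and "b = j * (j - 1) div 2"
  have "a = b + j"
    using triangular_step[of "j - 1"] by (simp add: a_def b_def mult.commute add.commute)
  moreover have "2 * b = j * (j - 1)"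
    by (simp add: b_def)
  ultimately have ab: "a + b = j * j"
    by (simp add: algebra_simps)
  have "\<bar>j\<bar> * 1 \<le> \<bar>j\<bar> * \<bar>j\<bar>"
    by (cases "j = 0") (simp, rule mult_left_mono, auto)
  hence "\<bar>j\<bar> \<le> a + b"
    by (simp add: ab abs_mult_self_eq)
  hence "nat \<bar>j\<bar> \<le> nat a + nat b"
    by linarith
  hence "fps_X ^ nat \<bar>j\<bar> dvd (fps_X ^ nat a * fps_X ^ nat b :: 'a fps)"
    unfolding power_add[symmetric] by (rule le_imp_power_dvd)
  also have "\<dots> dvd x ^ nat a * y ^ nat b"
    using X by (intro mult_dvd_mono dvd_power_same)
  finally show ?thesis
    by (simp only: ramanujan_term_def a_def b_def)
qed

text \<open>Quantitative form of the limit: Gaussian binomials tend to the inverse of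
  \<open>qpoch_inf q q\<close> as \<open>k\<close> and \<open>n - k\<close> grow.\<close>

lemma qbinomial_cong:
  fixes q :: "'a :: field fps"
  assumes "fps_nth q 0 = 0" "m \<le> k" "m \<le> n - k" "k \<le> n"
  shows "fps_X ^ m dvd qpoch_inf q q * qbinomial q n k - 1"
proof -
  let ?Q = "qpoch_inf q q" and ?c = "qbinomial q n k" and ?P = "\<lambda>n. \<Prod>i<n. 1 - q * q ^ i"
  note cong = qpoch_inf_cong[OF assms(1,1), of m]
  \<comment> \<open>Telescoping with \<open>?c * ?P k * ?P (n - k) = ?P n\<close>: each summand
    contains the error of one partial product. The surplus \<open>?Q\<close> is a unit and is
    cancelled afterwards.\<close>
  have "?Q * (?Q * ?c - 1) = ?c * ?Q * (?Q - ?P k) + ?c * ?P k * (?Q - ?P (n - k)) - (?Q - ?P n)"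
    using qbinomial_fact[OF assms(4), of q] by (simp only: ring_distribs mult_ac) simp
  also have "fps_X ^ m dvd \<dots>"
    using assms by (intro dvd_add dvd_diff dvd_mult cong) auto
  finally have "fps_X ^ m dvd inverse ?Q * (?Q * (?Q * ?c - 1))"
    by (rule dvd_mult)
  thus ?thesis
    using qpoch_inf_nth_0[OF assms(1,1)] by (simp add: mult.assoc[symmetric] inverse_mult_eq_1)
qed

text \<open>Limit of \<open>finite_triple_product\<close> with \<open>M = N\<close>, multiplied by
  \<open>?Q\<close>; coefficient \<open>n\<close> is compared at one sufficiently large
  \<open>N\<close>.\<close>

theorem jacobi_triple_product:
  fixes x y :: "'a :: field fps"
  assumes x: "fps_nth x 0 = 0" and y: "fps_nth y 0 = 0"
  shows "(ramanujan_term x y has_sum qpochs_inf [- x, - y, x * y] (x * y)) UNIV"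
proof (rule has_sum_fpsI)
  fix n
  let ?q = "x * y"
  let ?Q = "qpoch_inf ?q ?q"
  let ?t = "ramanujan_term x y"
  have q: "fps_nth ?q 0 = 0"
    using x by simp
  have large: "fps_nth (?t j) i = 0" if "i \<le> n" "int n < \<bar>j\<bar>" for i j
    using fps_X_power_dvd_ramanujan_term[OF x y, of j] that unfolding fps_X_power_dvd_iff by auto
  define K where "K = {j. \<bar>j\<bar> \<le> int n}"
  have "K = {- int n..int n}"
    by (auto simp: K_def)
  hence K: "finite K"
    by simp
  have sub: "{j \<in> UNIV. fps_nth (?t j) n \<noteq> 0} \<subseteq> K"
    using large[of n] by (force simp: K_def)
  thus "finite {j \<in> UNIV. fps_nth (?t j) n \<noteq> 0}"
    using K by (rule finite_subset)
  let ?P = "\<lambda>N. (\<Prod>k<N. 1 + x * ?q ^ k) * (\<Prod>k<N. 1 + y * ?q ^ k)"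
  have "(\<lambda>N. (\<Prod>k<N. 1 - (- x) * ?q ^ k) * (\<Prod>k<N. 1 - (- y) * ?q ^ k) * ?Q) \<longlonglongrightarrow>
        qpoch_inf (- x) ?q * qpoch_inf (- y) ?q * ?Q"
    using x y by (intro tendsto_mult tendsto_const qpoch_inf_tendsto) auto
  hence "(\<lambda>N. ?P N * ?Q) \<longlonglongrightarrow> qpochs_inf [- x, - y, ?q] ?q"
    by (simp add: qpochs_inf_def mult.assoc)
  hence "eventually (\<lambda>N. fps_nth (?P N * ?Q) n = fps_nth (qpochs_inf [- x, - y, ?q] ?q) n) sequentially"
    unfolding tendsto_fps_iff by blast
  \<comment> \<open>With \<open>N > 2 * n\<close>, every \<open>k\<close> at distance at most
    \<open>n\<close> from \<open>N\<close> has \<open>k\<close> and \<open>N + N - k\<close> at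
    least \<open>Suc n\<close>, as the congruence modulo \<open>fps_X ^ Suc n\<close>
    requires.\<close>
  hence "eventually (\<lambda>N. fps_nth (?P N * ?Q) n = fps_nth (qpochs_inf [- x, - y, ?q] ?q) n \<and> N > 2 * n) sequentially"
    by (intro eventually_conj eventually_gt_at_top)
  then obtain N where N: "fps_nth (?P N * ?Q) n = fps_nth (qpochs_inf [- x, - y, ?q] ?q) n" "N > 2 * n"
    using eventually_happens'[OF sequentially_bot] by blast
  have stable: "fps_nth (?Q * qbinomial ?q (N + N) k * ?t (int k - int N)) n = fps_nth (?t (int k - int N)) n"
    if "k \<le> N + N" for k
  proof -
    let ?j = "int k - int N"
    have "fps_X ^ Suc n dvd (?Q * qbinomial ?q (N + N) k - 1) * ?t ?j"
    proof (cases "\<bar>?j\<bar> \<le> int n")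
      case True
      thus ?thesis
        using N that by (intro dvd_mult2 qbinomial_cong q) auto
    next
      case False
      thus ?thesis
        by (intro dvd_mult) (auto simp: fps_X_power_dvd_iff large simp del: power_Suc)
    qed
    thus ?thesis
      by (simp add: fps_X_power_dvd_iff algebra_simps del: power_Suc)
  qed
  have "fps_nth (qpochs_inf [- x, - y, ?q] ?q) n =
        fps_nth (\<Sum>k\<le>N + N. ?Q * qbinomial ?q (N + N) k * ?t (int k - int N)) n"
    by (simp only: N(1)[symmetric] finite_triple_product sum_distrib_left sum_distrib_right mult_ac)
  also have "\<dots> = (\<Sum>k\<le>N + N. fps_nth (?t (int k - int N)) n)"
    by (simp add: fps_sum_nth stable)
  also have "\<dots> = (\<Sum>j=- int N..int N. fps_nth (?t j) n)"
    by (rule sum.reindex_bij_witness[of _ "\<lambda>j. nat (j + int N)" "\<lambda>k. int k - int N"]) auto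
  also have "\<dots> = (\<Sum>j | j \<in> UNIV \<and> fps_nth (?t j) n \<noteq> 0. fps_nth (?t j) n)"
    using sub N by (intro sum.mono_neutral_right) (force simp: K_def)+
  finally show "fps_nth (qpochs_inf [- x, - y, ?q] ?q) n = \<dots>" .
qed

subsection \<open>Theta series with monomial arguments\<close>

definition ramanujan_exponent :: "nat \<Rightarrow> nat \<Rightarrow> int \<Rightarrow> nat" where
  "ramanujan_exponent a b j = a * nat (j * (j + 1) div 2) + b * nat (j * (j - 1) div 2)"

text \<open>Doubling removes the divisions, so identities between exponents become polynomial
  identities over the integers.\<close>

lemma two_times_ramanujan_exponent:
  "2 * int (ramanujan_exponent a b j) = int a * (j * (j + 1)) + int b * (j * (j - 1))"
proof -
  have "0 \<le> j * (j + 1)" "0 \<le> j * (j - 1)"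
    by (auto simp: zero_le_mult_iff)
  moreover have "2 * (j * (j + 1) div 2) = j * (j + 1)" "2 * (j * (j - 1) div 2) = j * (j - 1)"
    by simp_all
  ultimately show ?thesis
    by (simp add: ramanujan_exponent_def distrib_left mult.left_commute[of 2])
qed

text \<open>Stands for \<open>c ^ (j * j)\<close> when \<open>c * c = 1\<close>.\<close>

definition parity_weight :: "'a :: ring_1 \<Rightarrow> int \<Rightarrow> 'a" where
  "parity_weight c j = (if even j then 1 else c)"

lemma ramanujan_term_monomial:
  assumes "c * c = (1 :: 'a :: field)"
  shows "ramanujan_term (fps_const c * fps_X ^ a) (fps_const c * fps_X ^ b) j =
         fps_const (parity_weight c j) * fps_X ^ ramanujan_exponent a b j"
proof -
  let ?m = "ramanujan_exponent 1 1 j"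
  have "2 * int ?m = 2 * (j * j)"
    unfolding two_times_ramanujan_exponent by (simp add: algebra_simps)
  hence "int ?m = j * j"
    by simp
  hence "even ?m = even j"
    by (metis even_mult_iff even_of_nat)
  moreover have "c ^ k = (if even k then 1 else c)" for k
    using assms by (induction k) auto
  ultimately have "c ^ ?m = parity_weight c j"
    by (simp add: parity_weight_def)
  thus ?thesis
    by (simp add: ramanujan_term_def ramanujan_exponent_def power_mult_distrib power_add
          power_mult[symmetric] fps_const_power mult_ac flip: fps_const_mult)
qed

text \<open>The product side of f(c q^a, c q^b), where c is a sign in the applications.\<close>

definition theta_fps :: "'a :: field \<Rightarrow> nat \<Rightarrow> nat \<Rightarrow> 'a fps" where
  "theta_fps c a b = qpoch_inf (- (fps_const c * fps_X ^ a)) (fps_X ^ (a + b)) *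
     qpoch_inf (- (fps_const c * fps_X ^ b)) (fps_X ^ (a + b)) *
     qpoch_inf (fps_X ^ (a + b)) (fps_X ^ (a + b))"

lemma theta_fps_commute: "theta_fps c a b = theta_fps c b a"
  by (simp add: theta_fps_def add.commute mult_ac)

lemma theta_fps_has_sum:
  assumes "c * c = (1 :: 'a :: field)" "a > 0" "b > 0"
  shows "((\<lambda>j. fps_const (parity_weight c j) * fps_X ^ ramanujan_exponent a b j) has_sum
          theta_fps c a b) UNIV"
proof -
  let ?x = "fps_const c * fps_X ^ a" and ?y = "fps_const c * fps_X ^ b"
  have "?x * ?y = fps_const (c * c) * fps_X ^ (a + b)"
    by (simp only: fps_const_mult[symmetric] power_add mult_ac)
  hence xy: "?x * ?y = fps_X ^ (a + b)"
    by (simp add: assms)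
  have "(ramanujan_term ?x ?y has_sum qpochs_inf [- ?x, - ?y, ?x * ?y] (?x * ?y)) UNIV"
    using assms by (intro jacobi_triple_product) auto
  thus ?thesis
    unfolding xy ramanujan_term_monomial[OF assms(1), abs_def]
    by (simp add: qpochs_inf_def theta_fps_def mult.assoc)
qed

text \<open>The exponents are \<open>5 * i^2 - 4 * i\<close> and \<open>5 * j^2 - 2 * j\<close>. As
  the leading coefficients agree, \<open>i = u + v\<close> or \<open>i = u + v + 1\<close>, with
  \<open>j = u - v\<close>, leaves no term in \<open>u * v\<close>, and each half factors. The two
  signs \<open>s\<close> serve the quotient and its reciprocal.\<close>

lemma theta_fps_dissection:
  assumes s: "s * s = (1 :: 'a :: field)"
  shows "theta_fps (- s) 1 9 * theta_fps s 3 7 =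
         theta_fps (- 1) 4 16 * theta_fps (- 1) 8 12 -
         fps_const s * fps_X * (theta_fps (- 1) 6 14 * theta_fps (- 1) 2 18)"
proof -
  let ?w = "parity_weight"
  define t :: "'a \<Rightarrow> nat \<Rightarrow> nat \<Rightarrow> int \<Rightarrow> 'a fps" where
    "t c a b j = fps_const (?w c j) * fps_X ^ ramanujan_exponent a b j" for c a b j
  have t: "(t c a b has_sum theta_fps c a b) UNIV" if "c * c = 1" "a > 0" "b > 0" for c a b
    using theta_fps_has_sum[OF that] by (simp add: t_def[abs_def])
  have t_mult: "t c a b i * t c' a' b' j = fps_const (?w c i * ?w c' j) *
      fps_X ^ (ramanujan_exponent a b i + ramanujan_exponent a' b' j)" for c c' a b a' b' i j
    by (simp add: t_def power_add mult_ac flip: fps_const_mult)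
  note prod = has_sum_fps_mult[OF t t, simplified]
  define P where "P = (\<lambda>(i, j). t (- s) 1 9 i * t s 3 7 j)"
  have P: "(P has_sum theta_fps (- s) 1 9 * theta_fps s 3 7) UNIV"
    unfolding P_def using s by (intro prod) auto
  define h0 :: "int \<times> int \<Rightarrow> int \<times> int" where "h0 = (\<lambda>(u, v). (u + v, u - v))"
  define h1 :: "int \<times> int \<Rightarrow> int \<times> int" where "h1 = (\<lambda>(u, v). (u + v + 1, u - v))"
  have inj: "inj h0" "inj h1"
    by (auto simp: h0_def h1_def inj_on_def)
  \<comment> \<open>The witnesses invert the change of variables; the parity condition makes the
    halves integral.\<close>
  have "p \<in> range h0" if "even (fst p + snd p)" for p
    by (rule image_eqI[of _ _ "((fst p + snd p) div 2, (fst p - snd p) div 2)"])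
       (use that in \<open>auto simp: h0_def prod_eq_iff\<close>, presburger+)
  hence range0: "range h0 = {p. even (fst p + snd p)}"
    by (auto simp: h0_def)
  have "p \<in> range h1" if "odd (fst p + snd p)" for p
    by (rule image_eqI[of _ _ "((fst p + snd p - 1) div 2, (fst p - snd p - 1) div 2)"])
       (use that in \<open>auto simp: h1_def prod_eq_iff\<close>, presburger+)
  hence range1: "range h1 = {p. odd (fst p + snd p)}"
    by (auto simp: h1_def)
  \<comment> \<open>Here both indices have the same parity, so the sign is 1 or
    \<open>- s * s = - 1\<close>. In \<open>w1\<close> the parities differ and a single
    \<open>- s\<close> or \<open>s\<close> remains.\<close>
  have w0: "?w (- s) (u + v) * ?w s (u - v) = ?w (- 1) u * ?w (- 1) v" for u v
    using s by (auto simp: parity_weight_def)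
  have w1: "?w (- s) (u + v + 1) * ?w s (u - v) = - s * (?w (- 1) u * ?w (- 1) v)" for u v
    using s by (auto simp: parity_weight_def)
  have e0: "ramanujan_exponent 1 9 (u + v) + ramanujan_exponent 3 7 (u - v) =
            ramanujan_exponent 4 16 u + ramanujan_exponent 8 12 v" for u v
  proof -
    have "2 * int (ramanujan_exponent 1 9 (u + v)) + 2 * int (ramanujan_exponent 3 7 (u - v)) =
          2 * int (ramanujan_exponent 4 16 u) + 2 * int (ramanujan_exponent 8 12 v)"
      unfolding two_times_ramanujan_exponent by (simp add: algebra_simps)
    thus ?thesis by linarith
  qed
  have e1: "ramanujan_exponent 1 9 (u + v + 1) + ramanujan_exponent 3 7 (u - v) =
            Suc (ramanujan_exponent 14 6 u + ramanujan_exponent 18 2 v)" for u v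
  proof -
    have "2 * int (ramanujan_exponent 1 9 (u + v + 1)) + 2 * int (ramanujan_exponent 3 7 (u - v)) =
          2 * int (ramanujan_exponent 14 6 u) + 2 * int (ramanujan_exponent 18 2 v) + 2"
      unfolding two_times_ramanujan_exponent by (simp add: algebra_simps)
    thus ?thesis by linarith
  qed
  have "P \<circ> h0 = (\<lambda>(u, v). t (- 1) 4 16 u * t (- 1) 8 12 v)"
    unfolding P_def h0_def t_mult by (auto simp: fun_eq_iff t_mult w0 e0 simp del: One_nat_def)
  hence "((P \<circ> h0) has_sum theta_fps (- 1) 4 16 * theta_fps (- 1) 8 12) UNIV"
    using prod[of "- 1" 4 16 "- 1" 8 12] by simp
  hence "(P has_sum theta_fps (- 1) 4 16 * theta_fps (- 1) 8 12) (range h0)"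
    by (simp add: has_sum_reindex[OF inj(1)])
  moreover have "P \<circ> h1 = (\<lambda>x. fps_const (- s) * fps_X * (case x of (u, v) \<Rightarrow> t (- 1) 14 6 u * t (- 1) 18 2 v))"
    unfolding P_def h1_def t_mult
    by (auto simp: fun_eq_iff t_mult w1 e1 simp del: One_nat_def)
  hence "((P \<circ> h1) has_sum fps_const (- s) * fps_X * (theta_fps (- 1) 14 6 * theta_fps (- 1) 18 2)) UNIV"
    using has_sum_cmult_right[OF prod[of "- 1" 14 6 "- 1" 18 2]] by simp
  hence "(P has_sum fps_const (- s) * fps_X * (theta_fps (- 1) 14 6 * theta_fps (- 1) 18 2)) (range h1)"
    by (simp only: has_sum_reindex[OF inj(2)])
  ultimately have "(P has_sum theta_fps (- 1) 4 16 * theta_fps (- 1) 8 12 +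
      fps_const (- s) * fps_X * (theta_fps (- 1) 14 6 * theta_fps (- 1) 18 2)) (range h0 \<union> range h1)"
    by (rule has_sum_Un_disjoint) (auto simp: range0 range1)
  also have "range h0 \<union> range h1 = UNIV"
    by (auto simp: range0 range1)
  finally show ?thesis
    using has_sum_unique[OF P]
    by (simp add: theta_fps_commute[of _ 14 6] theta_fps_commute[of _ 18 2] flip: fps_const_neg)
qed

text \<open>An exponent plus one is \<open>6 * j^2 - 2 * j + 1 = (j - 1)^2 + 5 * j^2\<close>, and
  squares modulo 5 are 0, 1 or 4.\<close>

lemma theta_fps_4_8_nth:
  assumes "(n + 1) mod 5 \<in> {2, 3}"
  shows "fps_nth (theta_fps (- 1 :: 'a :: field) 4 8) n = 0"
proof -
  have "ramanujan_exponent 4 8 j \<noteq> n" for j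
  proof
    assume "ramanujan_exponent 4 8 j = n"
    hence "2 * int n = 4 * (j * (j + 1)) + 8 * (j * (j - 1))"
      using two_times_ramanujan_exponent[of 4 8 j] by simp
    hence n: "int (n + 1) = (j - 1) * (j - 1) + 5 * (j * j)"
      by (simp add: algebra_simps)
    have "int ((n + 1) mod 5) = ((j - 1) mod 5 * ((j - 1) mod 5)) mod 5"
      unfolding zmod_int n by (simp add: mod_mult_eq)
    moreover have "(j - 1) mod 5 \<in> {0, 1, 2, 3, 4}"
      by auto
    ultimately show False
      using assms by auto
  qed
  hence "fps_nth (fps_const (parity_weight (- 1 :: 'a) j) * fps_X ^ ramanujan_exponent 4 8 j) n = 0" for j
    by auto
  hence "fps_nth (theta_fps (- 1 :: 'a) 4 8) n = (\<Sum>j | j \<in> UNIV \<and> False. 0)"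
    by (subst has_sum_fpsD(2)[OF theta_fps_has_sum]) (auto simp del: fps_mult_left_const_nth)
  thus ?thesis by simp
qed

subsection \<open>Power series in a power of the variable\<close>

definition supported_on_multiples :: "nat \<Rightarrow> 'a :: zero fps \<Rightarrow> bool" where
  "supported_on_multiples d f \<longleftrightarrow> (\<forall>n. \<not> d dvd n \<longrightarrow> fps_nth f n = 0)"

lemma supported_on_multiples_1: "supported_on_multiples d (1 :: 'a :: ring_1 fps)"
  by (auto simp: supported_on_multiples_def)

lemma supported_on_multiples_X_power:
  "d dvd m \<Longrightarrow> supported_on_multiples d (fps_X ^ m :: 'a :: comm_ring_1 fps)"
  by (auto simp: supported_on_multiples_def)

lemma supported_on_multiples_add:
  fixes f g :: "'a :: ring_1 fps"
  shows "supported_on_multiples d f \<Longrightarrow> supported_on_multiples d g \<Longrightarrow> supported_on_multiples d (f + g)"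
  by (auto simp: supported_on_multiples_def)

lemma supported_on_multiples_uminus:
  fixes f :: "'a :: ring_1 fps"
  shows "supported_on_multiples d f \<Longrightarrow> supported_on_multiples d (- f)"
  by (auto simp: supported_on_multiples_def)

lemma supported_on_multiples_diff:
  fixes f g :: "'a :: ring_1 fps"
  shows "supported_on_multiples d f \<Longrightarrow> supported_on_multiples d g \<Longrightarrow> supported_on_multiples d (f - g)"
  by (auto simp: supported_on_multiples_def)

lemma supported_on_multiples_mult:
  fixes f g :: "'a :: ring_1 fps"
  assumes "supported_on_multiples d f" "supported_on_multiples d g"
  shows "supported_on_multiples d (f * g)"
  unfolding supported_on_multiples_def
proof safe
  fix n assume n: "\<not> d dvd n"
  show "fps_nth (f * g) n = 0"
    unfolding fps_mult_nth
  proof (rule sum.neutral, rule ballI)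
    fix i assume "i \<in> {0..n}"
    hence "\<not> d dvd i \<or> \<not> d dvd n - i"
      using n dvd_add[of d i "n - i"] by auto
    thus "fps_nth f i * fps_nth g (n - i) = 0"
      using assms by (auto simp: supported_on_multiples_def)
  qed
qed

lemma supported_on_multiples_power:
  fixes f :: "'a :: ring_1 fps"
  shows "supported_on_multiples d f \<Longrightarrow> supported_on_multiples d (f ^ k)"
  by (induction k) (auto intro: supported_on_multiples_1 supported_on_multiples_mult)

lemma supported_on_multiples_prod:
  fixes f :: "'b \<Rightarrow> 'a :: comm_ring_1 fps"
  shows "(\<And>i. i \<in> I \<Longrightarrow> supported_on_multiples d (f i)) \<Longrightarrow> supported_on_multiples d (\<Prod>i\<in>I. f i)"
  by (induction I rule: infinite_finite_induct)
     (auto intro: supported_on_multiples_1 supported_on_multiples_mult)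

text \<open>Strong induction along the recursion for the inverse: if \<open>d\<close> does not
  divide \<open>n\<close>, it fails to divide \<open>i\<close> or \<open>n - i\<close>.\<close>

lemma supported_on_multiples_inverse:
  fixes f :: "'a :: field fps"
  assumes "supported_on_multiples d f"
  shows "supported_on_multiples d (inverse f)"
proof -
  have "\<not> d dvd n \<longrightarrow> fps_nth (inverse f) n = 0" for n
  proof (induction n rule: less_induct)
    case (less n)
    show ?case
    proof
      assume n: "\<not> d dvd n"
      then obtain m where m: "n = Suc m"
        by (cases n) auto
      have "fps_nth f i * fps_nth (inverse f) (n - i) = 0" if "i \<in> {1..n}" for i
      proof (cases "d dvd i")
        case True
        hence "\<not> d dvd n - i"
          using n that dvd_add[of d i "n - i"] by auto
        thus ?thesis using less.IH[of "n - i"] that by auto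
      next
        case False
        thus ?thesis using assms by (simp add: supported_on_multiples_def)
      qed
      hence "(\<Sum>i=1..n. fps_nth f i * fps_nth (inverse f) (n - i)) = 0"
        by (intro sum.neutral) blast
      thus "fps_nth (inverse f) n = 0"
        using m by (simp add: fps_inverse_def)
    qed
  qed
  thus ?thesis by (simp add: supported_on_multiples_def)
qed

lemma supported_on_multiples_qpoch_inf:
  fixes A q :: "'a :: idom fps"
  assumes "fps_nth A 0 = 0" "fps_nth q 0 = 0" "supported_on_multiples d A" "supported_on_multiples d q"
  shows "supported_on_multiples d (qpoch_inf A q)"
proof -
  have "supported_on_multiples d (\<Prod>k\<le>n. 1 - A * q ^ k)" for n :: nat
    by (intro supported_on_multiples_prod supported_on_multiples_diff supported_on_multiples_mult
          supported_on_multiples_power supported_on_multiples_1 assms)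
  thus ?thesis
    by (simp add: supported_on_multiples_def qpoch_inf_fps_nth assms)
qed

text \<open>The common end of both cases. Expanding the square, the odd part of \<open>f\<close> is
  \<open>2 * c * fps_X * A * B * L / K\<close>, which \<open>dissect\<close> turns into
  \<open>2 * c * fps_X * E * H / G\<close>. Since \<open>H / G\<close> is a series in
  \<open>fps_X ^ 5\<close>, the residues 2 and 3 missing from \<open>fps_X * E\<close> stay
  missing.\<close>

lemma quotient_nth_eq_0:
  fixes f A B K L E G H :: "'a :: field fps"
  assumes f: "f * K = (A + fps_const c * fps_X * B) ^ 2 * L"
    and dissect: "A * B * L * G = K * E * H"
    and units: "fps_nth K 0 \<noteq> 0" "fps_nth G 0 \<noteq> 0"
    and even: "supported_on_multiples 2 A" "supported_on_multiples 2 B"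
       "supported_on_multiples 2 K" "supported_on_multiples 2 L"
    and five: "supported_on_multiples 5 G" "supported_on_multiples 5 H"
    and E: "\<And>n. (n + 1) mod 5 \<in> {2, 3} \<Longrightarrow> fps_nth E n = 0"
    and n: "odd n" "n mod 5 \<in> {2, 3}"
  shows "fps_nth f n = 0"
proof -
  define U where "U = (A ^ 2 + fps_const (c ^ 2) * fps_X ^ 2 * B ^ 2) * L * inverse K"
  define V where "V = H * inverse G"
  have K: "K * inverse K = 1" and G: "G * inverse G = 1"
    by (intro inverse_mult_eq_1' units)+
  have "A * B * L * inverse K = E * V * (K * inverse K)"
  proof -
    have "A * B * L * inverse K = A * B * L * G * inverse G * inverse K"
      using G by (simp add: mult.assoc)
    also have "\<dots> = E * V * (K * inverse K)"
      unfolding dissect by (simp add: V_def mult_ac)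
    finally show ?thesis .
  qed
  hence EV: "A * B * L * inverse K = E * V"
    by (simp add: K)
  have "f = f * K * inverse K"
    using K by (simp add: mult.assoc)
  also have "\<dots> = U + fps_const (2 * c) * (fps_X * (A * B * L * inverse K))"
    unfolding f U_def
    by (simp add: power2_eq_square algebra_simps flip: fps_const_mult)
  finally have f_eq: "f = U + fps_const (2 * c) * (fps_X * E * V)"
    unfolding EV by (simp add: mult.assoc)
  have "supported_on_multiples 2 (fps_const (c ^ 2))"
    by (auto simp: supported_on_multiples_def)
  hence "supported_on_multiples 2 U"
    unfolding U_def using even
    by (intro supported_on_multiples_mult supported_on_multiples_add supported_on_multiples_power
          supported_on_multiples_inverse supported_on_multiples_X_power) auto
  hence U: "fps_nth U n = 0"
    using n(1) by (simp add: supported_on_multiples_def)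
  have V: "supported_on_multiples 5 V"
    unfolding V_def using five by (intro supported_on_multiples_mult supported_on_multiples_inverse)
  have XE: "fps_nth (fps_X * E) i = 0" if "i mod 5 \<in> {2, 3}" for i
    using E[of "i - 1"] that by (cases i) auto
  have "fps_nth (fps_X * E * V) n = 0"
    unfolding fps_mult_nth[of "fps_X * E"]
  proof (rule sum.neutral, rule ballI)
    fix i assume i: "i \<in> {0..n}"
    show "fps_nth (fps_X * E) i * fps_nth V (n - i) = 0"
    proof (cases "5 dvd n - i")
      case True
      hence "i mod 5 = n mod 5"
        using i by (metis atLeastAtMost_iff mod_eq_dvd_iff_nat)
      thus ?thesis using XE n by simp
    next
      case False
      thus ?thesis using V by (simp add: supported_on_multiples_def)
    qed
  qed
  thus ?thesis
    by (simp add: f_eq U)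
qed

subsection \<open>The two quotients\<close>

abbreviation qpoch_X :: "nat \<Rightarrow> nat \<Rightarrow> rat fps" where
  "qpoch_X a m \<equiv> qpoch_inf (fps_X ^ a) (fps_X ^ m)"

abbreviation qpoch_neg_X :: "nat \<Rightarrow> nat \<Rightarrow> rat fps" where
  "qpoch_neg_X a m \<equiv> qpoch_inf (- (fps_X ^ a)) (fps_X ^ m)"

lemma qpoch_X_split:
  assumes "a > 0" "m > 0" "d > 0"
  shows "qpoch_X a m = (\<Prod>i<d. qpoch_X (a + m * i) (m * d))"
  using qpoch_inf_split[of "fps_X ^ a :: rat fps" "fps_X ^ m" d] assms
  by (simp add: power_add power_mult)

lemma qpoch_X_split2:
  assumes "a > 0" "m > 0"
  shows "qpoch_X a m = qpoch_X a (2 * m) * qpoch_X (a + m) (2 * m)"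
  using qpoch_X_split[of a m 2] assms by (simp add: numeral_2_eq_2 mult.commute)

lemma qpoch_X_mult_neg:
  assumes "a > 0" "m > 0"
  shows "qpoch_X a m * qpoch_neg_X a m = qpoch_X (2 * a) (2 * m)"
  using qpoch_inf_mult_minus[of "fps_X ^ a :: rat fps" "fps_X ^ m"] assms
  by (simp add: power_mult[symmetric] mult.commute)

lemma supported_on_multiples_qpoch_X:
  assumes "a > 0" "m > 0" "d dvd a" "d dvd m"
  shows "supported_on_multiples d (qpoch_X a m)" "supported_on_multiples d (qpoch_neg_X a m)"
  using assms
  by (intro supported_on_multiples_qpoch_inf supported_on_multiples_uminus
        supported_on_multiples_X_power; simp)+

lemma fps_const_minus_1_mult: "fps_const (- 1) * f = - (f :: 'a :: ring_1 fps)"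
  by (simp flip: fps_const_neg)

lemma theta_fps_rat:
  "theta_fps (- 1) a b = qpoch_X a (a + b) * qpoch_X b (a + b) * qpoch_X (a + b) (a + b)"
  "theta_fps 1 a b = qpoch_neg_X a (a + b) * qpoch_neg_X b (a + b) * qpoch_X (a + b) (a + b)"
  by (simp_all add: theta_fps_def fps_const_minus_1_mult)

text \<open>Splitting (q^4; q^4) into 3 classes gives the theta product with base q^12; splitting it
  into 5 gives the factors with base q^20.\<close>

lemma theta_fps_4_8_eq:
  "theta_fps (- 1) 4 8 =
     qpoch_X 4 20 * qpoch_X 16 20 * (qpoch_X 8 20 * qpoch_X 12 20) * qpoch_X 20 20"
proof -
  have three: "{..<3} = {0, 1, 2 :: nat}" and five: "{..<5} = {0, 1, 2, 3, 4 :: nat}"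
    by auto
  have "theta_fps (- 1) 4 8 = qpoch_X 4 4"
    using qpoch_X_split[of 4 4 3] three by (simp add: theta_fps_rat mult_ac)
  also have "\<dots> = qpoch_X 4 20 * qpoch_X 16 20 * (qpoch_X 8 20 * qpoch_X 12 20) * qpoch_X 20 20"
    using qpoch_X_split[of 4 4 5] five by (simp add: mult_ac)
  finally show ?thesis .
qed

theorem theorem1p1:
  fixes \<alpha> \<beta> :: "nat \<Rightarrow> int" and n :: nat
  assumes "Abs_fps (\<lambda>n. of_int (\<alpha> n) :: rat) =
    (qpochs_inf [fps_X, fps_X ^ 4] (fps_X ^ 5) ^ 2 *
     qpochs_inf [- (fps_X ^ 4), - (fps_X ^ 6)] (fps_X ^ 10)) /
    (qpochs_inf [fps_X ^ 2, fps_X ^ 3] (fps_X ^ 5) ^ 2 *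
     qpochs_inf [- (fps_X ^ 2), - (fps_X ^ 8)] (fps_X ^ 10))"
  assumes "Abs_fps (\<lambda>n. of_int (\<beta> n) :: rat) =
    (qpochs_inf [fps_X ^ 2, fps_X ^ 3] (fps_X ^ 5) ^ 2 *
     qpochs_inf [- (fps_X ^ 2), - (fps_X ^ 8)] (fps_X ^ 10)) /
    (qpochs_inf [fps_X, fps_X ^ 4] (fps_X ^ 5) ^ 2 *
     qpochs_inf [- (fps_X ^ 4), - (fps_X ^ 6)] (fps_X ^ 10))"
  shows "\<alpha> (10 * n + 3) = 0 \<and> \<alpha> (10 * n + 7) = 0 \<and>
         \<beta> (10 * n + 3) = 0 \<and> \<beta> (10 * n + 7) = 0"
proof -
  \<comment> \<open>Pairs with base q^20 are the common currency: \<open>T2\<close>,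
    \<open>T4\<close> and each product of a \<open>T\<close> with its \<open>S\<close> are monomials
    in them.\<close>
  let ?a2 = "qpoch_X 2 20 * qpoch_X 18 20" and ?a4 = "qpoch_X 4 20 * qpoch_X 16 20"
    and ?a6 = "qpoch_X 6 20 * qpoch_X 14 20" and ?a8 = "qpoch_X 8 20 * qpoch_X 12 20"
    and ?J = "qpoch_X 10 10" and ?J' = "qpoch_X 20 20"
  define T1 T2 T3 T4 where "T1 = qpoch_X 1 10 * qpoch_X 9 10" and "T2 = qpoch_X 2 10 * qpoch_X 8 10"
    and "T3 = qpoch_X 3 10 * qpoch_X 7 10" and "T4 = qpoch_X 4 10 * qpoch_X 6 10"
  define S1 S2 S3 S4 where "S1 = qpoch_neg_X 1 10 * qpoch_neg_X 9 10"
    and "S2 = qpoch_neg_X 2 10 * qpoch_neg_X 8 10"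
    and "S3 = qpoch_neg_X 3 10 * qpoch_neg_X 7 10" and "S4 = qpoch_neg_X 4 10 * qpoch_neg_X 6 10"
  note T_defs = T1_def T2_def T3_def T4_def and S_defs = S1_def S2_def S3_def S4_def
  have TS: "T1 * S1 = ?a2" "T2 * S2 = ?a4" "T3 * S3 = ?a6" "T4 * S4 = ?a8"
    using qpoch_X_mult_neg[of 1 10] qpoch_X_mult_neg[of 9 10] qpoch_X_mult_neg[of 2 10]
      qpoch_X_mult_neg[of 8 10] qpoch_X_mult_neg[of 3 10] qpoch_X_mult_neg[of 7 10]
      qpoch_X_mult_neg[of 4 10] qpoch_X_mult_neg[of 6 10]
    unfolding T_defs S_defs by (simp_all add: mult_ac)
  have T2: "T2 = ?a2 * ?a8" and T4: "T4 = ?a4 * ?a6"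
    using qpoch_X_split2[of 2 10] qpoch_X_split2[of 8 10] qpoch_X_split2[of 4 10] qpoch_X_split2[of 6 10]
    unfolding T_defs by (simp_all add: mult_ac)
  \<comment> \<open>\<open>A\<close> and \<open>B\<close> are the two products of the dissection;
    \<open>E\<close> is \<open>theta_fps (- 1) 4 8\<close>.\<close>
  define A B E where "A = ?a4 * ?a8 * ?J' ^ 2" and "B = ?a6 * ?a2 * ?J' ^ 2" and "E = ?a4 * ?a8 * ?J'"
  note dissection = theta_fps_dissection[where 'a = rat]
  have W: "T1 * S3 * ?J ^ 2 = A + fps_const (- 1) * fps_X * B"
          "T3 * S1 * ?J ^ 2 = A + fps_const 1 * fps_X * B"
    using dissection[of 1] dissection[of "- 1"]
    by (simp_all add: theta_fps_rat fps_const_minus_1_mult T_defs S_defs A_def B_def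
          power2_eq_square[of ?J] power2_eq_square[of ?J'] mult_ac)
  have num: "qpochs_inf [fps_X, fps_X ^ 4] (fps_X ^ 5) = T1 * T4"
    using qpoch_X_split2[of 1 5] qpoch_X_split2[of 4 5]
    by (simp add: qpochs_inf_def T_defs mult_ac)
  have den: "qpochs_inf [fps_X ^ 2, fps_X ^ 3] (fps_X ^ 5) = T2 * T3"
    using qpoch_X_split2[of 2 5] qpoch_X_split2[of 3 5]
    by (simp add: qpochs_inf_def T_defs mult_ac)
  have neg: "qpochs_inf [- (fps_X ^ 4), - (fps_X ^ 6)] (fps_X ^ 10) = S4"
            "qpochs_inf [- (fps_X ^ 2), - (fps_X ^ 8)] (fps_X ^ 10) = S2"
    by (simp_all add: qpochs_inf_def S_defs)
  have one: "fps_nth T1 0 = 1" "fps_nth T2 0 = 1" "fps_nth T3 0 = 1" "fps_nth T4 0 = 1"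
            "fps_nth S1 0 = 1" "fps_nth S2 0 = 1" "fps_nth S3 0 = 1" "fps_nth S4 0 = 1"
            "fps_nth ?a2 0 = 1" "fps_nth ?a6 0 = 1" "fps_nth ?J 0 = 1" "fps_nth ?J' 0 = 1"
    unfolding T_defs S_defs by (simp_all add: qpoch_inf_nth_0)
  note supp_intros = supported_on_multiples_mult supported_on_multiples_power supported_on_multiples_qpoch_X
  have even: "supported_on_multiples 2 A" "supported_on_multiples 2 B" "supported_on_multiples 2 T2"
    "supported_on_multiples 2 T4" "supported_on_multiples 2 S2" "supported_on_multiples 2 S4"
    "supported_on_multiples 2 ?a2" "supported_on_multiples 2 ?a6" "supported_on_multiples 2 ?J"
    unfolding A_def B_def T_defs S_defs by (intro supp_intros; simp)+
  have five: "supported_on_multiples 5 (?J ^ 4)" "supported_on_multiples 5 (?J' ^ 3)"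
    by (intro supp_intros; simp)+
  have E: "fps_nth E i = 0" if "(i + 1) mod 5 \<in> {2, 3}" for i
    using theta_fps_4_8_nth[OF that, where 'a = rat] unfolding theta_fps_4_8_eq E_def .

  \<comment> \<open>Both quotients as the square of a dissected series times a series in q^2\<close>
  let ?num = "T1 ^ 2 * T4 ^ 2 * S4" and ?den = "T2 ^ 2 * T3 ^ 2 * S2"
  have quotient: "f / g * g = f" if "fps_nth g 0 = 1" for f g :: "rat fps"
    using that by (simp add: fps_divide_unit mult.assoc inverse_mult_eq_1)
  have f_alpha: "Abs_fps (\<lambda>n. of_int (\<alpha> n)) * ?den = ?num"
    unfolding assms(1) num den neg using one by (simp add: power_mult_distrib quotient)
  have f_beta: "Abs_fps (\<lambda>n. of_int (\<beta> n)) * ?num = ?den"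
    unfolding assms(2) num den neg using one by (simp add: power_mult_distrib quotient)

  \<comment> \<open>Multiplying by \<open>S3 ^ 2 * ?J ^ 4\<close> completes \<open>T1 ^ 2\<close> to
    the square of the first series in \<open>W\<close>, while \<open>T3 * S3 = ?a6\<close> makes
    \<open>K\<close> a series in q^2. For the reciprocal, \<open>S1\<close> completes
    \<open>T3 ^ 2\<close>, and \<open>T1 * S1 = ?a2\<close>.\<close>
  define K L where "K = T2 ^ 2 * S2 * ?a6 ^ 2 * ?J ^ 4" and "L = T4 ^ 2 * S4"
  define K' L' where "K' = T4 ^ 2 * S4 * ?a2 ^ 2 * ?J ^ 4" and "L' = T2 ^ 2 * S2"
  have K: "K = ?den * (S3 ^ 2 * ?J ^ 4)"
    unfolding K_def TS(3)[symmetric] by (simp add: power_mult_distrib mult_ac)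
  have K': "K' = ?num * (S1 ^ 2 * ?J ^ 4)"
    unfolding K'_def TS(1)[symmetric] by (simp add: power_mult_distrib mult_ac)
  have J4: "?J ^ 4 = (?J ^ 2) ^ 2"
    by (simp flip: power_mult)
  have alpha: "Abs_fps (\<lambda>n. of_int (\<alpha> n)) * K = (A + fps_const (- 1) * fps_X * B) ^ 2 * L"
    unfolding K mult.assoc[of _ ?den, symmetric] f_alpha W[symmetric] L_def J4
    by (simp only: power_mult_distrib mult_ac)
  have beta: "Abs_fps (\<lambda>n. of_int (\<beta> n)) * K' = (A + fps_const 1 * fps_X * B) ^ 2 * L'"
    unfolding K' mult.assoc[of _ ?num, symmetric] f_beta W[symmetric] L'_def J4
    by (simp only: power_mult_distrib mult_ac)
  \<comment> \<open>Both sides reduce to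
    \<open>?a2 * ?a4^2 * ?a6^2 * ?a8^2 * ?J^4 * ?J'^4\<close>.\<close>
  have dissect: "A * B * L * ?J ^ 4 = K * E * ?J' ^ 3"
  proof -
    have L: "L = T4 * ?a8" and K: "K = T2 * ?a4 * ?a6 ^ 2 * ?J ^ 4"
      unfolding L_def K_def TS[symmetric] by (simp_all add: power2_eq_square mult_ac)
    show ?thesis
      unfolding L K T2 T4 A_def B_def E_def
      by (simp add: power2_eq_square power3_eq_cube power4_eq_xxxx mult_ac)
  qed
  \<comment> \<open>The same cancellation with \<open>?a2\<close> and \<open>?a6\<close> exchanged,
    and \<open>?a4\<close> and \<open>?a8\<close>; this fixes \<open>A\<close>, \<open>B\<close> and
    \<open>E\<close> and swaps \<open>T2\<close> with \<open>T4\<close>.\<close>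
  have dissect': "A * B * L' * ?J ^ 4 = K' * E * ?J' ^ 3"
  proof -
    have L: "L' = T2 * ?a4" and K: "K' = T4 * ?a8 * ?a2 ^ 2 * ?J ^ 4"
      unfolding L'_def K'_def TS[symmetric] by (simp_all add: power2_eq_square mult_ac)
    show ?thesis
      unfolding L K T2 T4 A_def B_def E_def
      by (simp add: power2_eq_square power3_eq_cube power4_eq_xxxx mult_ac)
  qed
  have units: "fps_nth K 0 \<noteq> 0" "fps_nth K' 0 \<noteq> 0" "fps_nth (?J ^ 4) 0 \<noteq> 0"
    unfolding K_def K'_def using one by (simp_all add: fps_nth_power_0)
  have even_KL: "supported_on_multiples 2 K" "supported_on_multiples 2 L"
                "supported_on_multiples 2 K'" "supported_on_multiples 2 L'"
    unfolding K_def L_def K'_def L'_def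
    by (intro supported_on_multiples_mult supported_on_multiples_power even)+
  have zero: "\<alpha> m = 0" "\<beta> m = 0" if "odd m" "m mod 5 \<in> {2, 3}" for m
    using quotient_nth_eq_0[OF alpha dissect units(1,3) even(1,2) even_KL(1,2) five E that]
      quotient_nth_eq_0[OF beta dissect' units(2,3) even(1,2) even_KL(3,4) five E that]
    by simp_all
  \<comment> \<open>The classes 3 and 7 modulo 10 are exactly the odd numbers with residue 3 or 2
    modulo 5.\<close>
  have "odd (10 * n + 3)" "(10 * n + 3) mod 5 \<in> {2, 3}" "odd (10 * n + 7)" "(10 * n + 7) mod 5 \<in> {2, 3}"
    by (auto, presburger+)
  thus ?thesis
    using zero by blast
qed

end
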